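(* Let $p>q>0$ be real numbers, and let $f,g:[1,\infty)\to\mathbb{R}$ be measurable functions with $\int_1^\infty f^2(x)\frac{dx}{x^{q+1}}<\infty$ and $\int_1^\infty g^2(x)\frac{dx}{x^{p+1}}<\infty$. Then $$\int_1^\infty\left(\int_1^x f(y)\,g\!\left(\frac{x}{y}\right)\frac{dy}{y}\right)^2\frac{dx}{x^{p+1}}\le\frac{1}{p-q}\int_1^\infty f^2(x)\frac{dx}{x^{q+1}}\int_1^\infty g^2(x)\frac{dx}{x^{p+1}}.$$ *)

theory Defs
  imports "HOL-Analysis.Analysis"
begin

end

theory Submission
  imports Defs
begin

text \<open>
  Split the integrand \<open>f y * g (x / y) / y\<close> as
  \<open>(f y * g (x / y) * y powr ((p - q - 1) / 2)) * y powr ((q - p - 1) / 2)\<close>.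
  The square of the second factor integrates to \<open>1 / (p - q)\<close> over \<open>{1..}\<close>, so Cauchy--Schwarz
  bounds the squared convolution uniformly in \<open>x\<close>. By Tonelli and the substitution \<open>x = y * t\<close>
  the remaining double integral, weighted by \<open>x powr (- p - 1)\<close>, is exactly the product of the
  two given integrals. Tonelli needs joint measurability, so \<open>f\<close> and \<open>g\<close> are first replaced by
  Borel functions; since \<open>y \<mapsto> x / y\<close> is smooth off \<open>0\<close>, this changes \<open>y \<mapsto> g (x / y)\<close> only on
  a null set for every \<open>x \<noteq> 0\<close>.
\<close>

section \<open>Null sets under reflection, and Borel representatives\<close>

text \<open>The map \<open>t \<mapsto> x / t\<close> is its own inverse off 0, so the exceptional
  \<open>y\<close> lie in the image of a null set under a differentiable map. The guard
  \<open>y \<noteq> 0\<close> sets aside the default value \<open>x / 0 = 0\<close>.\<close>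

lemma AE_lebesgue_reflect:
  fixes x :: real
  assumes "AE t in lebesgue. P t" and "x \<noteq> 0"
  shows "AE y in lebesgue. y \<noteq> 0 \<longrightarrow> P (x / y)"
proof -
  obtain N where N: "N \<in> null_sets lebesgue" "{t. \<not> P t} \<subseteq> N"
    using assms(1) by (auto simp: eventually_ae_filter)
  have "negligible ((\<lambda>t. x / t) ` (N - {0}))"
  proof (rule negligible_differentiable_image_negligible)
    show "negligible (N - {0})"
      using N(1) by (intro negligible_diff) (simp add: negligible_iff_null_sets)
    show "(\<lambda>t. x / t) differentiable_on N - {0}"
      unfolding differentiable_on_def by (auto intro!: derivative_intros)
  qed simp
  then have "(\<lambda>t. x / t) ` (N - {0}) \<in> null_sets lebesgue"
    by (simp add: negligible_iff_null_sets)
  moreover have "{y \<in> space lebesgue. \<not> (y \<noteq> 0 \<longrightarrow> P (x / y))} \<subseteq> (\<lambda>t. x / t) ` (N - {0})"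
  proof
    fix y assume "y \<in> {y \<in> space lebesgue. \<not> (y \<noteq> 0 \<longrightarrow> P (x / y))}"
    then have "x / y \<in> N - {0}" "y = x / (x / y)"
      using N(2) \<open>x \<noteq> 0\<close> by auto
    then show "y \<in> (\<lambda>t. x / t) ` (N - {0})" by blast
  qed
  ultimately show ?thesis by (rule AE_I')
qed

lemma set_lebesgue_ex_borel:
  fixes f :: "real \<Rightarrow> real"
  assumes "set_borel_measurable lebesgue {1..} f"
  obtains F where "F \<in> borel_measurable borel" "\<And>x. x < 1 \<Longrightarrow> F x = 0"
    "AE x in lebesgue. indicator {1..} x * f x = F x"
proof -
  obtain h where h: "h \<in> borel_measurable lborel"
     "AE x in lborel. indicator {1..} x * f x = h x"
    using completion_ex_borel_measurable_real[of "\<lambda>x. indicator {1..} x * f x" lborel] assms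
    unfolding set_borel_measurable_def by auto
  show thesis
  \<comment> \<open>The Borel version \<open>h\<close> may be nonzero on a null set below 1.
    Multiplying by the indicator again makes it vanish there everywhere, which later pointwise case
    splits rely on.\<close>
  proof (rule that[of "\<lambda>x. indicator {1..} x * h x"])
    show "(\<lambda>x. indicator {1..} x * h x) \<in> borel_measurable borel" using h(1) by simp
    show "AE x in lebesgue. indicator {1..} x * f x = indicator {1..} x * h x"
      using AE_completion[OF h(2)] by eventually_elim (auto split: split_indicator)
  qed (simp)
qed

section \<open>Finiteness on bounded intervals and the tail of a power\<close>

text \<open>The reflection \<open>y \<mapsto> x / y\<close> maps \<open>{1..x}\<close> onto itself
  with Jacobian \<open>x / y\<^sup>2\<close>. This is at least \<open>1 / x\<close> there, so
  dropping it costs at most a factor \<open>x\<close>.\<close>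

lemma nn_integral_reflect_finite:
  fixes G :: "real \<Rightarrow> real"
  assumes G: "G \<in> borel_measurable borel" and x: "x \<ge> 1"
    and fin: "(\<integral>\<^sup>+t\<in>{1..x}. ennreal ((G t)\<^sup>2) \<partial>lborel) < \<infinity>"
  shows "(\<integral>\<^sup>+y\<in>{1..x}. ennreal ((G (x / y))\<^sup>2) \<partial>lborel) < \<infinity>"
proof -
  have [measurable]: "G \<in> borel_measurable borel" by fact
  have img: "(\<lambda>y. x / y) ` {1..x} = {1..x}"
  proof safe
    fix y assume "y \<in> {1..x}"
    then show "x / y \<in> {1..x}" using x by (auto simp: field_simps)
  next
    fix y assume "y \<in> {1..x}"
    then have "x / y \<in> {1..x}" "y = x / (x / y)" using x by (auto simp: field_simps)
    then show "y \<in> (\<lambda>y. x / y) ` {1..x}" by blast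
  qed
  have "integrable lborel (\<lambda>t. indicator {1..x} t * (G t)\<^sup>2)"
    using fin by (intro integrableI_bounded) (simp_all add: ennreal_mult ennreal_indicator mult.commute)
  then have "(\<lambda>t. (G t)\<^sup>2) absolutely_integrable_on {1..x}"
    unfolding set_integrable_def by (simp add: integrable_completion)
  moreover have "((\<lambda>y. x / y) has_field_derivative - (x / y\<^sup>2)) (at y within {1..x})" if "y \<in> {1..x}" for y
    using that by (auto intro!: derivative_eq_intros simp: power2_eq_square)
  moreover have "inj_on (\<lambda>y. x / y) {1..x}"
    using x by (auto simp: inj_on_def)
  \<comment> \<open>The change-of-variables rule is an equivalence that couples absolute
    integrability with the value of the integral, so that value is supplied although only
    integrability is extracted.\<close>
  ultimately have "(\<lambda>y. \<bar>- (x / y\<^sup>2)\<bar> * (G (x / y))\<^sup>2) absolutely_integrable_on {1..x}"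
    using has_absolute_integral_change_of_variables_1'[of "{1..x}" "\<lambda>y. x / y" "\<lambda>y. - (x / y\<^sup>2)" "\<lambda>t. (G t)\<^sup>2" "integral {1..x} (\<lambda>t. (G t)\<^sup>2)"]
    by (simp add: img)
  then have int: "integrable lborel (\<lambda>y. indicator {1..x} y * (x / y\<^sup>2 * (G (x / y))\<^sup>2))"
    unfolding set_integrable_def using x by (subst (asm) integrable_completion) auto
  have "(\<integral>\<^sup>+y\<in>{1..x}. ennreal ((G (x / y))\<^sup>2) \<partial>lborel)
     \<le> (\<integral>\<^sup>+y. ennreal x * ennreal (indicator {1..x} y * (x / y\<^sup>2 * (G (x / y))\<^sup>2)) \<partial>lborel)"
  proof (intro nn_integral_mono)
    fix y
    have "ennreal ((G (x / y))\<^sup>2) \<le> ennreal (x * (x / y\<^sup>2 * (G (x / y))\<^sup>2))" if "y \<in> {1..x}"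
    proof (rule ennreal_leI)
      have "1 * (G (x / y))\<^sup>2 \<le> (x\<^sup>2 / y\<^sup>2) * (G (x / y))\<^sup>2"
        using that by (intro mult_right_mono) (auto simp: power_mono)
      then show "(G (x / y))\<^sup>2 \<le> x * (x / y\<^sup>2 * (G (x / y))\<^sup>2)"
        by (simp add: power2_eq_square mult_ac)
    qed
    then show "ennreal ((G (x / y))\<^sup>2) * indicator {1..x} y
      \<le> ennreal x * ennreal (indicator {1..x} y * (x / y\<^sup>2 * (G (x / y))\<^sup>2))"
      using x by (auto split: split_indicator simp flip: ennreal_mult'')
  qed
  also have "\<dots> = ennreal x * (\<integral>\<^sup>+y. ennreal (indicator {1..x} y * (x / y\<^sup>2 * (G (x / y))\<^sup>2)) \<partial>lborel)"
    by (intro nn_integral_cmult) simp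
  also have "\<dots> < \<infinity>"
    using int x by (subst nn_integral_eq_integral) (auto simp: ennreal_mult_less_top)
  finally show ?thesis .
qed

text \<open>On \<open>{1..x}\<close> the weight \<open>1 / y powr r\<close> is at least
  \<open>1 / x powr r\<close>, so removing it costs at most the factor
  \<open>x powr r\<close>.\<close>

lemma nn_integral_square_local_finite:
  fixes F :: "real \<Rightarrow> real"
  assumes F: "F \<in> borel_measurable borel" and x: "x \<ge> 1" and r: "r \<ge> 0"
    and fin: "(\<integral>\<^sup>+y. ennreal ((F y)\<^sup>2 / y powr r) \<partial>lborel) < \<infinity>"
  shows "(\<integral>\<^sup>+y\<in>{1..x}. ennreal ((F y)\<^sup>2) \<partial>lborel) < \<infinity>"
proof -
  have [measurable]: "F \<in> borel_measurable borel" by fact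
  have "(\<integral>\<^sup>+y\<in>{1..x}. ennreal ((F y)\<^sup>2) \<partial>lborel)
      \<le> (\<integral>\<^sup>+y. ennreal (x powr r) * ennreal ((F y)\<^sup>2 / y powr r) \<partial>lborel)"
  proof (intro nn_integral_mono)
    fix y
    have "ennreal ((F y)\<^sup>2) \<le> ennreal (x powr r * ((F y)\<^sup>2 / y powr r))" if "y \<in> {1..x}"
    proof (rule ennreal_leI)
      have "1 * (F y)\<^sup>2 \<le> (x powr r / y powr r) * (F y)\<^sup>2"
        using that r by (intro mult_right_mono) (auto simp: powr_mono2)
      then show "(F y)\<^sup>2 \<le> x powr r * ((F y)\<^sup>2 / y powr r)" by simp
    qed
    then show "ennreal ((F y)\<^sup>2) * indicator {1..x} y
        \<le> ennreal (x powr r) * ennreal ((F y)\<^sup>2 / y powr r)"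
      by (auto split: split_indicator simp flip: ennreal_mult'')
  qed
  also have "\<dots> = ennreal (x powr r) * (\<integral>\<^sup>+y. ennreal ((F y)\<^sup>2 / y powr r) \<partial>lborel)"
    by (intro nn_integral_cmult) simp
  also have "\<dots> < \<infinity>" using fin by (simp add: ennreal_mult_less_top)
  finally show ?thesis .
qed

text \<open>The antiderivative \<open>- (y powr - b / b)\<close> tends to 0 at infinity because
  \<open>b > 0\<close>. With \<open>b = p - q\<close> this is the source of the constant
  \<open>1 / (p - q)\<close>.\<close>

lemma nn_integral_powr_tail:
  fixes b :: real
  assumes "b > 0"
  shows "(\<integral>\<^sup>+y\<in>{1..}. ennreal (y powr (- b - 1)) \<partial>lborel) = ennreal (1 / b)"
proof -
  have "(\<integral>\<^sup>+y\<in>{1..}. ennreal (y powr (- b - 1)) \<partial>lborel) = ennreal (0 - (- (1 powr - b / b)))"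
  proof (rule nn_integral_FTC_atLeast)
    show "((\<lambda>y. - (y powr - b / b)) has_real_derivative y powr (- b - 1)) (at y)" if "1 \<le> y" for y
      using that assms by (auto intro!: derivative_eq_intros)
    show "((\<lambda>y. - (y powr - b / b)) \<longlongrightarrow> 0) at_top"
      using tendsto_minus[OF tendsto_divide[OF tendsto_neg_powr[OF _ filterlim_ident] tendsto_const], of "- b" b] assms
      by simp
  qed auto
  then show ?thesis by simp
qed

section \<open>Estimates for the convolution of Borel functions\<close>

text \<open>Extension by zero makes \<open>y \<mapsto> F y * G (x / y)\<close> vanish outside \<open>{1..x}\<close>.\<close>

locale multiplicative_convolution =
  fixes p q :: real and F G :: "real \<Rightarrow> real"
  assumes pq: "p > q" "q > 0"
    and F [measurable]: "F \<in> borel_measurable borel" and F0: "\<And>x. x < 1 \<Longrightarrow> F x = 0"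
    and G [measurable]: "G \<in> borel_measurable borel" and G0: "\<And>x. x < 1 \<Longrightarrow> G x = 0"
begin

text \<open>Cauchy--Schwarz with Tonelli would give convergence only for almost every
  \<open>x\<close>; this gives it for each \<open>x \<ge> 1\<close>. On \<open>{1..x}\<close> one
  has \<open>1 / y \<le> 1\<close>, and \<open>\<bar>u * v\<bar> \<le> u\<^sup>2 + v\<^sup>2\<close>
  reduces the claim to local square integrability of both factors.\<close>

lemma nn_convolution_finite:
  assumes x: "x \<ge> 1"
    and A: "(\<integral>\<^sup>+y. ennreal ((F y)\<^sup>2 / y powr (q + 1)) \<partial>lborel) < \<infinity>"
    and B: "(\<integral>\<^sup>+y. ennreal ((G y)\<^sup>2 / y powr (p + 1)) \<partial>lborel) < \<infinity>"
  shows "(\<integral>\<^sup>+y. ennreal \<bar>F y * G (x / y) / y\<bar> \<partial>lborel) < \<infinity>"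
proof -
  have "(\<integral>\<^sup>+y. ennreal \<bar>F y * G (x / y) / y\<bar> \<partial>lborel)
     \<le> (\<integral>\<^sup>+y. ennreal ((F y)\<^sup>2) * indicator {1..x} y + ennreal ((G (x / y))\<^sup>2) * indicator {1..x} y \<partial>lborel)"
  proof (intro nn_integral_mono)
    fix y
    show "ennreal \<bar>F y * G (x / y) / y\<bar> \<le> ennreal ((F y)\<^sup>2) * indicator {1..x} y + ennreal ((G (x / y))\<^sup>2) * indicator {1..x} y"
    proof (cases "y \<in> {1..x}")
      case True
      have "\<bar>F y * G (x / y) / y\<bar> \<le> \<bar>F y\<bar> * \<bar>G (x / y)\<bar> / 1"
        unfolding abs_divide abs_mult using True by (intro divide_left_mono) auto
      also have "\<dots> \<le> (F y)\<^sup>2 + (G (x / y))\<^sup>2"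
        using sum_squares_bound[of "\<bar>F y\<bar>" "\<bar>G (x / y)\<bar>"]
          mult_nonneg_nonneg[of "\<bar>F y\<bar>" "\<bar>G (x / y)\<bar>"] by (simp del: mult_nonneg_nonneg)
      finally show ?thesis using True by (simp flip: ennreal_plus)
    next
      case False
      then have "F y = 0 \<or> G (x / y) = 0"
        by (cases "y < 1") (auto simp: F0 intro!: G0)
      then show ?thesis by auto
    qed
  qed
  also have "\<dots> = (\<integral>\<^sup>+y\<in>{1..x}. ennreal ((F y)\<^sup>2) \<partial>lborel) + (\<integral>\<^sup>+y\<in>{1..x}. ennreal ((G (x / y))\<^sup>2) \<partial>lborel)"
    by (intro nn_integral_add) auto
  also have "\<dots> < \<infinity>"
    using nn_integral_square_local_finite[OF F x _ A]
      nn_integral_reflect_finite[OF G x nn_integral_square_local_finite[OF G x _ B]] pq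
    by (simp add: less_top)
  finally show ?thesis .
qed

lemma nn_convolution_square_le:
  "(\<integral>\<^sup>+y. ennreal \<bar>F y * G (x / y) / y\<bar> \<partial>lborel)\<^sup>2
    \<le> ennreal (1 / (p - q)) * (\<integral>\<^sup>+y. ennreal ((F y)\<^sup>2 * (G (x / y))\<^sup>2 * y powr (p - q - 1)) \<partial>lborel)"
proof -
  \<comment> \<open>The two exponents add up to \<open>- 1\<close>, which restores the factor
    \<open>1 / y\<close>. The indicator in \<open>?v\<close> cuts off the singularity at 0 and is
    harmless because \<open>F\<close> vanishes below 1.\<close>
  let ?u = "\<lambda>y. ennreal (\<bar>F y * G (x / y)\<bar> * y powr ((p - q - 1) / 2))"
  let ?v = "\<lambda>y. ennreal (y powr ((q - p - 1) / 2)) * indicator {1..} y"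
  have sq: "(y powr (r / 2))\<^sup>2 = y powr r" for y r :: real
    by (simp add: power2_eq_square flip: powr_add)
  have uv: "?u y * ?v y = ennreal \<bar>F y * G (x / y) / y\<bar>" for y
  proof (cases "y < 1")
    case False
    have "(p - q - 1) / 2 + (q - p - 1) / 2 = - 1"
      by (simp add: field_simps)
    then have inv: "y powr ((p - q - 1) / 2) * y powr ((q - p - 1) / 2) = inverse y"
      using False powr_add[of y "(p - q - 1) / 2" "(q - p - 1) / 2"] by (simp add: powr_minus)
    have "?u y * ?v y = ennreal (\<bar>F y * G (x / y)\<bar> * y powr ((p - q - 1) / 2) * y powr ((q - p - 1) / 2))"
      using False by (subst ennreal_mult) auto
    also have "\<dots> = ennreal \<bar>F y * G (x / y) / y\<bar>"
      using False by (simp only: mult.assoc inv) (simp add: divide_inverse abs_mult)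
    finally show ?thesis .
  next
    case True
    then show ?thesis by (simp add: F0)
  qed
  have [measurable]: "?u \<in> borel_measurable lborel" "?v \<in> borel_measurable lborel"
    by (auto intro!: borel_measurable_times borel_measurable_indicator)
  have "(\<integral>\<^sup>+y. ennreal \<bar>F y * G (x / y) / y\<bar> \<partial>lborel) = (\<integral>\<^sup>+y. ?u y * ?v y \<partial>lborel)"
    by (simp only: uv)
  moreover have "(\<integral>\<^sup>+y. ?u y * ?v y \<partial>lborel)\<^sup>2 \<le> (\<integral>\<^sup>+y. (?u y)\<^sup>2 \<partial>lborel) * (\<integral>\<^sup>+y. (?v y)\<^sup>2 \<partial>lborel)"
    by (rule Cauchy_Schwarz_nn_integral; fact)
  ultimately have "(\<integral>\<^sup>+y. ennreal \<bar>F y * G (x / y) / y\<bar> \<partial>lborel)\<^sup>2 \<le> (\<integral>\<^sup>+y. (?u y)\<^sup>2 \<partial>lborel) * (\<integral>\<^sup>+y. (?v y)\<^sup>2 \<partial>lborel)"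
    by simp
  also have "(\<lambda>y. (?u y)\<^sup>2) = (\<lambda>y. ennreal ((F y)\<^sup>2 * (G (x / y))\<^sup>2 * y powr (p - q - 1)))"
    by (rule ext) (simp add: ennreal_power power_mult_distrib sq)
  also have "(\<lambda>y. (?v y)\<^sup>2) = (\<lambda>y. ennreal (y powr (- (p - q) - 1)) * indicator {1..} y)"
    by (rule ext) (simp add: ennreal_power sq split: split_indicator)
  also have "nn_integral lborel \<dots> = ennreal (1 / (p - q))"
    using pq by (intro nn_integral_powr_tail) simp
  finally show ?thesis by (simp only: mult.commute)
qed

text \<open>For fixed \<open>y > 0\<close>, putting \<open>x = y * t\<close> turns
  \<open>x powr (- p - 1)\<close> times dx into \<open>y powr (- p) * t powr (- p - 1)\<close> times
  dt. Together with \<open>y powr (p - q - 1)\<close> this leaves exactly the weight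
  \<open>y powr (- q - 1)\<close> of \<open>F\<close>, which explains the exponents in the
  Cauchy--Schwarz splitting.\<close>

lemma nn_integral_convolution_weighted:
  "(\<integral>\<^sup>+x. (\<integral>\<^sup>+y. ennreal ((F y)\<^sup>2 * (G (x / y))\<^sup>2 * y powr (p - q - 1)) \<partial>lborel) * ennreal (1 / x powr (p + 1)) \<partial>lborel)
    = (\<integral>\<^sup>+y. ennreal ((F y)\<^sup>2 / y powr (q + 1)) \<partial>lborel) * (\<integral>\<^sup>+t. ennreal ((G t)\<^sup>2 / t powr (p + 1)) \<partial>lborel)"
    (is "?L = _ * ?B")
proof -
  have "?L = (\<integral>\<^sup>+x. (\<integral>\<^sup>+y. ennreal ((F y)\<^sup>2 * (G (x / y))\<^sup>2 * y powr (p - q - 1)) * ennreal (1 / x powr (p + 1)) \<partial>lborel) \<partial>lborel)"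
    by (intro nn_integral_cong nn_integral_multc [symmetric]) auto
  \<comment> \<open>Tonelli: the integrand is jointly measurable in \<open>x\<close> and
    \<open>y\<close> because \<open>F\<close> and \<open>G\<close> are Borel.\<close>
  also have "\<dots> = (\<integral>\<^sup>+y. (\<integral>\<^sup>+x. ennreal ((F y)\<^sup>2 * (G (x / y))\<^sup>2 * y powr (p - q - 1)) * ennreal (1 / x powr (p + 1)) \<partial>lborel) \<partial>lborel)"
    by (intro lborel_pair.Fubini') auto
  also have "\<dots> = (\<integral>\<^sup>+y. ennreal ((F y)\<^sup>2 / y powr (q + 1)) * ?B \<partial>lborel)"
  proof (intro nn_integral_cong)
    fix y :: real
    show "(\<integral>\<^sup>+x. ennreal ((F y)\<^sup>2 * (G (x / y))\<^sup>2 * y powr (p - q - 1)) * ennreal (1 / x powr (p + 1)) \<partial>lborel)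
       = ennreal ((F y)\<^sup>2 / y powr (q + 1)) * ?B"
    proof (cases "y < 1")
      case False
      then have y: "y > 0" by simp
      have "(\<integral>\<^sup>+x. ennreal ((F y)\<^sup>2 * (G (x / y))\<^sup>2 * y powr (p - q - 1)) * ennreal (1 / x powr (p + 1)) \<partial>lborel)
        = ennreal \<bar>y\<bar> * (\<integral>\<^sup>+t. ennreal ((F y)\<^sup>2 * (G ((0 + y * t) / y))\<^sup>2 * y powr (p - q - 1)) * ennreal (1 / (0 + y * t) powr (p + 1)) \<partial>lborel)"
        using y by (intro nn_integral_real_affine) auto
      also have "\<dots> = (\<integral>\<^sup>+t. ennreal \<bar>y\<bar> * (ennreal ((F y)\<^sup>2 * (G ((0 + y * t) / y))\<^sup>2 * y powr (p - q - 1)) * ennreal (1 / (0 + y * t) powr (p + 1))) \<partial>lborel)"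
        by (intro nn_integral_cmult [symmetric]) auto
      also have "\<dots> = (\<integral>\<^sup>+t. ennreal ((F y)\<^sup>2 / y powr (q + 1)) * ennreal ((G t)\<^sup>2 / t powr (p + 1)) \<partial>lborel)"
      proof (intro nn_integral_cong)
        fix t :: real
        have "y * ((F y)\<^sup>2 * (G t)\<^sup>2 * y powr (p - q - 1) * (1 / (y * t) powr (p + 1)))
           = (F y)\<^sup>2 / y powr (q + 1) * ((G t)\<^sup>2 / t powr (p + 1))"
        proof (cases "t < 1")
          case False
          \<comment> \<open>The leading \<open>y\<close> is the Jacobian of the scaling, and
            \<open>1 + (p - q - 1) + (q + 1) = p + 1\<close>.\<close>
          have "y * y powr (p - q - 1) * y powr (q + 1) = y powr (p + 1)"
            using y powr_add[of y 1 "p - q - 1"] powr_add[of y "p - q" "q + 1"] by simp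
          moreover have "y powr (q + 1) > 0" "y powr (p + 1) > 0" "t powr (p + 1) > 0"
            using y False by auto
          ultimately show ?thesis using y False by (simp add: powr_mult field_simps)
        qed (simp add: G0)
        then show "ennreal \<bar>y\<bar> * (ennreal ((F y)\<^sup>2 * (G ((0 + y * t) / y))\<^sup>2 * y powr (p - q - 1)) * ennreal (1 / (0 + y * t) powr (p + 1)))
          = ennreal ((F y)\<^sup>2 / y powr (q + 1)) * ennreal ((G t)\<^sup>2 / t powr (p + 1))"
          using y by (simp flip: ennreal_mult)
      qed
      also have "\<dots> = ennreal ((F y)\<^sup>2 / y powr (q + 1)) * ?B"
        by (intro nn_integral_cmult) auto
      finally show ?thesis .
    qed (simp add: F0)
  qed
  also have "\<dots> = (\<integral>\<^sup>+y. ennreal ((F y)\<^sup>2 / y powr (q + 1)) \<partial>lborel) * ?B"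
    by (intro nn_integral_multc) auto
  finally show ?thesis .
qed

end

section \<open>Transfer to the given Lebesgue measurable functions\<close>

text \<open>Changing the integrand on a null set preserves its integral, and integrability makes the
  nonnegative integral the image of a real number. This supplies the finiteness required of
  \<open>F\<close> and \<open>G\<close>.\<close>

lemma nn_integral_weighted_square_eq:
  fixes f F :: "real \<Rightarrow> real"
  assumes F: "AE x in lebesgue. indicator {1..} x * f x = F x"
    and int: "set_integrable lebesgue {1..} (\<lambda>x. (f x)\<^sup>2 / x powr r)"
  shows "(\<integral>\<^sup>+x. ennreal ((F x)\<^sup>2 / x powr r) \<partial>lborel)
    = ennreal (LINT x:{1..}|lebesgue. (f x)\<^sup>2 / x powr r)"
proof -
  have "(\<integral>\<^sup>+x. ennreal ((F x)\<^sup>2 / x powr r) \<partial>lborel) = (\<integral>\<^sup>+x. ennreal ((F x)\<^sup>2 / x powr r) \<partial>lebesgue)"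
    by (simp add: nn_integral_completion)
  also have "\<dots> = (\<integral>\<^sup>+x. ennreal (indicator {1..} x *\<^sub>R ((f x)\<^sup>2 / x powr r)) \<partial>lebesgue)"
  proof (rule nn_integral_cong_AE)
    show "AE x in lebesgue. ennreal ((F x)\<^sup>2 / x powr r)
        = ennreal (indicator {1..} x *\<^sub>R ((f x)\<^sup>2 / x powr r))"
      using F
    proof eventually_elim
      case (elim x)
      show ?case unfolding elim [symmetric] by (simp split: split_indicator)
    qed
  qed
  also have "\<dots> = ennreal (LINT x:{1..}|lebesgue. (f x)\<^sup>2 / x powr r)"
    using int unfolding set_integrable_def set_lebesgue_integral_def
    by (intro nn_integral_eq_integral) (auto split: split_indicator)
  finally show ?thesis .
qed

theorem mainTheorem9:
  fixes p q :: real and f g :: "real \<Rightarrow> real"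
  assumes "p > q" and "q > 0"
    and "set_borel_measurable lebesgue {1..} f"
    and "set_borel_measurable lebesgue {1..} g"
    and "set_integrable lebesgue {1..} (\<lambda>x. (f x)\<^sup>2 / x powr (q + 1))"
    and "set_integrable lebesgue {1..} (\<lambda>x. (g x)\<^sup>2 / x powr (p + 1))"
  shows "(\<forall>x\<ge>1. set_integrable lebesgue {1..x} (\<lambda>y. f y * g (x / y) / y))
    \<and> set_integrable lebesgue {1..}
        (\<lambda>x. (LINT y:{1..x}|lebesgue. f y * g (x / y) / y)\<^sup>2 / x powr (p + 1))
    \<and> (LINT x:{1..}|lebesgue. (LINT y:{1..x}|lebesgue. f y * g (x / y) / y)\<^sup>2 / x powr (p + 1))
        \<le> 1 / (p - q) * (LINT x:{1..}|lebesgue. (f x)\<^sup>2 / x powr (q + 1))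
            * (LINT x:{1..}|lebesgue. (g x)\<^sup>2 / x powr (p + 1))"
proof -
  obtain F where F [measurable]: "F \<in> borel_measurable borel" and F0: "\<And>x. x < 1 \<Longrightarrow> F x = 0"
    and fF: "AE x in lebesgue. indicator {1..} x * f x = F x"
    using set_lebesgue_ex_borel[OF assms(3)] by blast
  obtain G where G [measurable]: "G \<in> borel_measurable borel" and G0: "\<And>x. x < 1 \<Longrightarrow> G x = 0"
    and gG: "AE x in lebesgue. indicator {1..} x * g x = G x"
    using set_lebesgue_ex_borel[OF assms(4)] by blast
  interpret multiplicative_convolution p q F G
    using assms(1,2) F F0 G G0 by unfold_locales
  define a where "a = (LINT x:{1..}|lebesgue. (f x)\<^sup>2 / x powr (q + 1))"
  define b where "b = (LINT x:{1..}|lebesgue. (g x)\<^sup>2 / x powr (p + 1))"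
  have A: "(\<integral>\<^sup>+x. ennreal ((F x)\<^sup>2 / x powr (q + 1)) \<partial>lborel) = ennreal a"
    unfolding a_def by (rule nn_integral_weighted_square_eq[OF fF assms(5)])
  have B: "(\<integral>\<^sup>+x. ennreal ((G x)\<^sup>2 / x powr (p + 1)) \<partial>lborel) = ennreal b"
    unfolding b_def by (rule nn_integral_weighted_square_eq[OF gG assms(6)])
  have ab: "a \<ge> 0" "b \<ge> 0"
    unfolding a_def b_def set_lebesgue_integral_def by (auto intro!: integral_nonneg_AE)
  \<comment> \<open>Integrating the Borel representatives over the whole line makes \<open>H\<close>
    Borel as a parametrized integral.\<close>
  define H where "H x = (LINT y|lborel. F y * G (x / y) / y)" for x
  have H [measurable]: "H \<in> borel_measurable borel"
    unfolding H_def by measurable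
  have fin: "integrable lborel (\<lambda>y. F y * G (x / y) / y)" if "x \<ge> 1" for x
    using nn_convolution_finite[OF that] A B
    by (intro integrableI_bounded) auto
  \<comment> \<open>For \<open>y\<close> in \<open>{1..x}\<close> both \<open>y\<close> and
    \<open>x / y\<close> are at least 1, so both almost-everywhere identities apply; elsewhere both
    sides are 0. The null set may depend on \<open>x\<close>, as the inner integral is taken for
    fixed \<open>x\<close>.\<close>
  have eq: "AE y in lebesgue. F y * G (x / y) / y = indicator {1..x} y *\<^sub>R (f y * g (x / y) / y)"
    if "x \<ge> 1" for x
  proof -
    have "AE y in lebesgue. y \<noteq> 0 \<longrightarrow> indicator {1..} (x / y) * g (x / y) = G (x / y)"
      using that by (intro AE_lebesgue_reflect[OF gG]) simp
    with fF show ?thesis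
    proof eventually_elim
      case (elim y)
      show ?case
      proof (cases "1 \<le> y \<and> y \<le> x")
        case True
        then have "x / y \<ge> 1" by simp
        with True elim that show ?thesis by auto
      next
        case False
        then have "F y = 0 \<or> G (x / y) = 0"
          using that by (cases "y < 1") (auto simp: F0 intro!: G0)
        with False show ?thesis by auto
      qed
    qed
  qed
  \<comment> \<open>Equality with \<open>H\<close> holds at every \<open>x \<ge> 1\<close>, so the
    outer integrand inherits measurability from \<open>H\<close>.\<close>
  have conv: "set_integrable lebesgue {1..x} (\<lambda>y. f y * g (x / y) / y)"
    "(LINT y:{1..x}|lebesgue. f y * g (x / y) / y) = H x" if x: "x \<ge> 1" for x
  proof -
    have v: "(\<lambda>y. F y * G (x / y) / y) \<in> borel_measurable lborel" by measurable
    then have v': "(\<lambda>y. F y * G (x / y) / y) \<in> borel_measurable lebesgue"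
      by (rule measurable_completion)
    have u: "(\<lambda>y. indicator {1..x} y *\<^sub>R (f y * g (x / y) / y)) \<in> borel_measurable lebesgue"
      by (rule borel_measurable_AE[OF v' eq[OF x]])
    have "integrable lebesgue (\<lambda>y. F y * G (x / y) / y)"
      using fin[OF x] integrable_completion[OF v] by simp
    then show "set_integrable lebesgue {1..x} (\<lambda>y. f y * g (x / y) / y)"
      unfolding set_integrable_def by (rule integrable_cong_AE_imp[OF _ u eq[OF x]])
    show "(LINT y:{1..x}|lebesgue. f y * g (x / y) / y) = H x"
      unfolding set_lebesgue_integral_def H_def
        integral_cong_AE[OF v' u eq[OF x], symmetric] by (rule integral_completion[OF v])
  qed
  define W where "W x = indicator {1..} x *\<^sub>R ((H x)\<^sup>2 / x powr (p + 1))" for x :: real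
  have W [measurable]: "W \<in> borel_measurable lborel"
    unfolding W_def by measurable
  have W_eq: "indicator {1..} x *\<^sub>R ((LINT y:{1..x}|lebesgue. f y * g (x / y) / y)\<^sup>2 / x powr (p + 1)) = W x" for x
    unfolding W_def by (cases "x \<ge> 1") (simp_all add: conv(2))
  have W_nonneg: "W x \<ge> 0" for x
    unfolding W_def by simp
  let ?M = "\<lambda>x. \<integral>\<^sup>+y. ennreal ((F y)\<^sup>2 * (G (x / y))\<^sup>2 * y powr (p - q - 1)) \<partial>lborel"
  \<comment> \<open>Here \<open>fin\<close> makes \<open>H x\<close> a genuine integral, bounded in
    absolute value by the integral of absolute values, to which the Cauchy--Schwarz bound applies
    after squaring.\<close>
  have W_le: "ennreal (W x) \<le> ennreal (1 / (p - q)) * (?M x * ennreal (1 / x powr (p + 1)))" for x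
  proof (cases "x \<ge> 1")
    case True
    have "ennreal \<bar>H x\<bar> \<le> (\<integral>\<^sup>+y. ennreal \<bar>F y * G (x / y) / y\<bar> \<partial>lborel)"
      using integral_norm_bound_ennreal[OF fin[OF True]] unfolding H_def real_norm_def .
    then have "(ennreal \<bar>H x\<bar>)\<^sup>2 \<le> (\<integral>\<^sup>+y. ennreal \<bar>F y * G (x / y) / y\<bar> \<partial>lborel)\<^sup>2"
      by (rule power_mono) simp
    also note nn_convolution_square_le
    finally have "ennreal ((H x)\<^sup>2) \<le> ennreal (1 / (p - q)) * ?M x"
      by (simp add: ennreal_power)
    then have "ennreal ((H x)\<^sup>2) * ennreal (1 / x powr (p + 1))
        \<le> ennreal (1 / (p - q)) * ?M x * ennreal (1 / x powr (p + 1))"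
      by (rule mult_right_mono) simp
    then show ?thesis
      using True unfolding W_def by (simp add: mult.assoc flip: ennreal_mult'')
  qed (simp add: W_def)
  have "(\<integral>\<^sup>+x. ennreal (W x) \<partial>lborel)
      \<le> (\<integral>\<^sup>+x. ennreal (1 / (p - q)) * (?M x * ennreal (1 / x powr (p + 1))) \<partial>lborel)"
    by (intro nn_integral_mono W_le)
  also have "\<dots> = ennreal (1 / (p - q)) * (\<integral>\<^sup>+x. ?M x * ennreal (1 / x powr (p + 1)) \<partial>lborel)"
    by (intro nn_integral_cmult) measurable
  also have "\<dots> = ennreal (1 / (p - q) * a * b)"
    unfolding nn_integral_convolution_weighted A B
    using pq ab by (simp add: mult.assoc flip: ennreal_mult)
  finally have bound: "(\<integral>\<^sup>+x. ennreal (W x) \<partial>lborel) \<le> ennreal (1 / (p - q) * a * b)" .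
  \<comment> \<open>The finite bound yields integrability first, so the final inequality concerns a
    genuine integral and not the default value 0.\<close>
  have W_int: "integrable lborel W"
    using bound W_nonneg by (intro integrableI_bounded) (auto simp: le_less_trans[OF _ ennreal_less_top])
  have "ennreal (integral\<^sup>L lborel W) \<le> ennreal (1 / (p - q) * a * b)"
    using bound W_nonneg by (simp add: nn_integral_eq_integral[OF W_int])
  then have W_bound: "integral\<^sup>L lborel W \<le> 1 / (p - q) * a * b"
    using pq ab by (subst (asm) ennreal_le_iff) auto
  \<comment> \<open>Only set integrals over \<open>{1..}\<close> are unfolded. The inner ones over
    \<open>{1..x}\<close> stay intact so that \<open>W_eq\<close> can rewrite the outer integrand,
    after which completion lemmas pass from \<open>lborel\<close> to
    \<open>lebesgue\<close>.\<close>
  show ?thesis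
    using conv(1) W_int W_bound
    unfolding set_integrable_def [of _ "{1..}"] set_lebesgue_integral_def [of _ "{1..}"] W_eq
      a_def [unfolded set_lebesgue_integral_def] b_def [unfolded set_lebesgue_integral_def]
    by (simp add: integrable_completion integral_completion)
qed

end
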